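(* For every integer $k\ge 3$, there exist infinitely many pairwise non-isomorphic $k$-graphs $(X,\mathscr{M})$ such that (1) $(X,\mathscr{M})$ is asymmetric, and (2) every non-trivial sub-$k$-graph $(X',\mathscr{M}')$ of $(X,\mathscr{M})$ with at least two vertices is symmetric.
   Context: A $k$-graph is a pair $(X,\mathscr{M})$ with $X$ a finite set and $\mathscr{M}\subseteq\binom{X}{k}$. An automorphism is a bijection $\phi:X\to X$ with $\{\phi(M):M\in\mathscr{M}\}=\mathscr{M}$. A $k$-graph is asymmetric if its only automorphism is the identity, and symmetric otherwise. A sub-$k$-graph of $(X,\mathscr{M})$ is a $k$-graph $(X',\mathscr{M}')$ with $X'\subseteq X$ and $\mathscr{M}'\subseteq\mathscr{M}$ (not necessarily induced); it is non-trivial if $1<|X'|<|X|$. *)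

theory Defs
  imports "HOL-Library.Ramsey"
begin

text \<open>
  A hypergraph is a pair \<open>(X, \<M>)\<close> of a vertex set and an edge set.
  Maps between vertex sets are functions on the whole vertex type; only their values
  on the vertex set matter.
\<close>

type_synonym 'a hgraph = "'a set \<times> 'a set set"

definition kgraph :: "nat \<Rightarrow> 'a hgraph \<Rightarrow> bool" where
  "kgraph k G \<longleftrightarrow> finite (fst G) \<and> snd G \<subseteq> nsets (fst G) k"

definition isomorphism :: "'a hgraph \<Rightarrow> 'b hgraph \<Rightarrow> ('a \<Rightarrow> 'b) \<Rightarrow> bool" where
  "isomorphism G H \<phi> \<longleftrightarrow>
     bij_betw \<phi> (fst G) (fst H) \<and> {\<phi> ` M | M. M \<in> snd G} = snd H"

definition isomorphic :: "'a hgraph \<Rightarrow> 'b hgraph \<Rightarrow> bool" where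
  "isomorphic G H \<longleftrightarrow> (\<exists>\<phi>. isomorphism G H \<phi>)"

definition automorphism :: "'a hgraph \<Rightarrow> ('a \<Rightarrow> 'a) \<Rightarrow> bool" where
  "automorphism G \<phi> \<longleftrightarrow> isomorphism G G \<phi>"

definition asymmetric :: "'a hgraph \<Rightarrow> bool" where
  "asymmetric G \<longleftrightarrow> (\<forall>\<phi>. automorphism G \<phi> \<longrightarrow> (\<forall>x \<in> fst G. \<phi> x = x))"

definition symmetric :: "'a hgraph \<Rightarrow> bool" where
  "symmetric G \<longleftrightarrow> \<not> asymmetric G"

text \<open>Sub-\<open>k\<close>-graphs need not be induced.\<close>

definition sub_kgraph :: "nat \<Rightarrow> 'a hgraph \<Rightarrow> 'a hgraph \<Rightarrow> bool" where
  "sub_kgraph k H G \<longleftrightarrow> kgraph k H \<and> fst H \<subseteq> fst G \<and> snd H \<subseteq> snd G"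

text \<open>Non-triviality constrains the numbers of vertices only, so a subgraph of \<open>G\<close> on
  the full vertex set of \<open>G\<close> counts as trivial even if it lacks some edges.\<close>

definition nontrivial_sub_kgraph :: "nat \<Rightarrow> 'a hgraph \<Rightarrow> 'a hgraph \<Rightarrow> bool" where
  "nontrivial_sub_kgraph k H G \<longleftrightarrow>
     sub_kgraph k H G \<and> 1 < card (fst H) \<and> card (fst H) < card (fst G)"

end

theory Submission
  imports Defs "HOL-Library.Nat_Bijection" "HOL-Combinatorics.Transposition"
begin

text \<open>
  Take a loose cycle of triples \<open>e 0, \<dots>, e (n - 1)\<close> and add one triple \<open>e n\<close> through the vertex
  of degree one of \<open>e 0\<close>, the vertex shared by \<open>e 0\<close> and \<open>e 1\<close>, and one new vertex. The only
  vertex of degree three anchors \<open>e 0\<close>, \<open>e 1\<close>, \<open>e n\<close>, and rigidity spreads from there along the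
  cycle. To reach uniformity \<open>k\<close>, add \<open>k - 3\<close> pairs of vertices, the two vertices of a pair lying
  on complementary sets of edges.

  Call two vertices twins if they lie on the same edges. Exchanging twins is an automorphism, so an
  asymmetric subgraph has none. If it contains \<open>e i\<close> but not \<open>e (i + 1)\<close>, then two vertices of
  \<open>e i\<close> are twins; hence it contains the whole cycle. If it has fewer vertices, it is exactly the
  cycle on all vertices but the new one, and a reflection of the cycle is a non-trivial automorphism.
\<close>

section \<open>Twins, and automorphisms as permutations of edge indices\<close>

text \<open>Vertices are described by the set \<open>r x\<close> of (indices of) edges through them, so that
  automorphisms become permutations of the edge indices.\<close>

definition dual :: "'a set \<Rightarrow> ('a \<Rightarrow> 'b set) \<Rightarrow> 'b set \<Rightarrow> 'a hgraph" where
  "dual V r S = (V, (\<lambda>i. {x\<in>V. i \<in> r x}) ` S)"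

text \<open>Every edge contains both of \<open>x\<close> and \<open>y\<close> or neither, so their
  transposition maps each edge to itself.\<close>

lemma symmetric_twins:
  assumes "x \<in> fst H" "y \<in> fst H" "x \<noteq> y"
    and twins: "\<And>M. M \<in> snd H \<Longrightarrow> x \<in> M \<longleftrightarrow> y \<in> M"
  shows "symmetric H"
proof -
  let ?\<phi> = "Transposition.transpose x y"
  have "?\<phi> ` M = M" if "M \<in> snd H" for M
    using twins[OF that] by (rule transpose_image_eq)
  moreover have "bij_betw ?\<phi> (fst H) (fst H)"
    using assms(1,2) by (simp add: bij_betw_transpose_iff)
  ultimately have "automorphism H ?\<phi>"
    by (simp add: automorphism_def isomorphism_def Setcompr_eq_image)
  moreover have "?\<phi> x \<noteq> x" using assms by simp
  ultimately show ?thesis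
    unfolding symmetric_def asymmetric_def using assms(1) by blast
qed

text \<open>A permutation of the indices lifts to the vertices: \<open>\<phi> x\<close> is the
  vertex whose set of edges is the image of \<open>r x\<close> under \<open>\<sigma>\<close>.
  Injectivity of \<open>\<sigma>\<close> and \<open>r\<close> passes to \<open>\<phi>\<close>, and
  finiteness makes it a bijection.\<close>

lemma dual_automorphism:
  assumes "finite V" "inj_on r V" and sub: "\<And>x. x \<in> V \<Longrightarrow> r x \<subseteq> S"
    and \<sigma>: "bij_betw \<sigma> S S" and ex: "\<And>x. x \<in> V \<Longrightarrow> \<sigma> ` r x \<in> r ` V"
  obtains \<phi> where "automorphism (dual V r S) \<phi>" "\<And>x. x \<in> V \<Longrightarrow> r (\<phi> x) = \<sigma> ` r x"
proof -
  have "\<forall>x\<in>V. \<exists>y. y \<in> V \<and> r y = \<sigma> ` r x" using ex by (metis imageE)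
  then obtain \<phi> where \<phi>: "\<And>x. x \<in> V \<Longrightarrow> \<phi> x \<in> V" "\<And>x. x \<in> V \<Longrightarrow> r (\<phi> x) = \<sigma> ` r x"
    by metis
  have inj\<sigma>: "inj_on \<sigma> S" and im: "\<sigma> ` S = S" using \<sigma> by (auto simp: bij_betw_def)
  have "inj_on \<phi> V"
    by (rule inj_onI) (metis \<phi>(2) sub inj_on_image_eq_iff[OF inj\<sigma>] assms(2) inj_onD)
  then have bij: "bij_betw \<phi> V V"
    using \<phi>(1) assms(1) by (simp add: bij_betw_def endo_inj_surj image_subsetI)
  have edge: "\<phi> ` {x\<in>V. i \<in> r x} = {x\<in>V. \<sigma> i \<in> r x}" if "i \<in> S" for i
  proof -
    have "\<sigma> i \<in> r (\<phi> x) \<longleftrightarrow> i \<in> r x" if "x \<in> V" for x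
      using \<phi>(2)[OF that] inj_on_image_mem_iff[OF inj\<sigma> \<open>i \<in> S\<close> sub[OF that]] by simp
    then have "\<phi> ` {x\<in>V. i \<in> r x} = {y \<in> \<phi> ` V. \<sigma> i \<in> r y}" by blast
    then show ?thesis using bij by (simp add: bij_betw_def)
  qed
  have "{\<phi> ` M |M. M \<in> (\<lambda>i. {x\<in>V. i \<in> r x}) ` S} = (\<lambda>i. {x\<in>V. \<sigma> i \<in> r x}) ` S"
    using edge by (simp add: Setcompr_eq_image image_image)
  also have "\<dots> = (\<lambda>i. {x\<in>V. i \<in> r x}) ` \<sigma> ` S" by (simp add: image_image)
  finally have "automorphism (dual V r S) \<phi>"
    using bij im by (simp add: automorphism_def isomorphism_def dual_def)
  then show ?thesis using that \<phi>(2) by blast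
qed

text \<open>Distinct indices name distinct edges, so an automorphism \<open>\<phi>\<close> induces a
  permutation \<open>\<sigma>\<close> of \<open>S\<close> that carries \<open>r x\<close> to
  \<open>r (\<phi> x)\<close>. Once \<open>\<sigma>\<close> is the identity, injectivity of
  \<open>r\<close> gives \<open>\<phi> x = x\<close>.\<close>

lemma asymmetric_dual:
  assumes "finite S" "inj_on r V" and sub: "\<And>x. x \<in> V \<Longrightarrow> r x \<subseteq> S"
    and inj: "inj_on (\<lambda>i. {x\<in>V. i \<in> r x}) S"
    and rigid: "\<And>\<sigma> i. bij_betw \<sigma> S S \<Longrightarrow> (\<And>A. A \<in> r ` V \<Longrightarrow> \<sigma> ` A \<in> r ` V) \<Longrightarrow> i \<in> S \<Longrightarrow> \<sigma> i = i"
  shows "asymmetric (dual V r S)"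
  unfolding asymmetric_def
proof (intro allI impI ballI)
  fix \<phi> x0 assume aut: "automorphism (dual V r S) \<phi>" and x0: "x0 \<in> fst (dual V r S)"
  define e where "e = (\<lambda>i. {x\<in>V. i \<in> r x})"
  have bij: "bij_betw \<phi> V V" and edges: "(`) \<phi> ` e ` S = e ` S"
    using aut unfolding automorphism_def isomorphism_def dual_def e_def Setcompr_eq_image
    by simp_all
  have inj\<phi>: "inj_on \<phi> V" and im\<phi>: "\<phi> ` V = V" using bij by (auto simp: bij_betw_def)
  have "\<exists>j. j \<in> S \<and> \<phi> ` e i = e j" if "i \<in> S" for i
  proof -
    have "\<phi> ` e i \<in> e ` S" using edges that by blast
    then show ?thesis by blast
  qed
  then obtain \<sigma> where \<sigma>: "\<And>i. i \<in> S \<Longrightarrow> \<sigma> i \<in> S" "\<And>i. i \<in> S \<Longrightarrow> \<phi> ` e i = e (\<sigma> i)"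
    by metis
  have eV: "e i \<subseteq> V" for i by (auto simp: e_def)
  have "inj_on \<sigma> S"
  proof (rule inj_onI)
    fix i j assume ij: "i \<in> S" "j \<in> S" "\<sigma> i = \<sigma> j"
    then have "\<phi> ` e i = \<phi> ` e j" using \<sigma>(2) by simp
    then have "e i = e j" using inj_on_image_eq_iff[OF inj\<phi> eV eV] by blast
    then show "i = j" using inj ij unfolding e_def by (auto dest: inj_onD)
  qed
  then have bij\<sigma>: "bij_betw \<sigma> S S"
    using \<sigma>(1) assms(1) by (simp add: bij_betw_def endo_inj_surj image_subsetI)
  have r\<phi>: "r (\<phi> x) = \<sigma> ` r x" if "x \<in> V" for x
  proof -
    have \<phi>V: "\<phi> x \<in> V" using im\<phi> that by blast
    have *: "\<sigma> i \<in> r (\<phi> x) \<longleftrightarrow> i \<in> r x" if "i \<in> S" for i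
    proof -
      have "\<sigma> i \<in> r (\<phi> x) \<longleftrightarrow> \<phi> x \<in> \<phi> ` e i" using \<sigma>(2)[OF that] \<phi>V by (simp add: e_def)
      also have "\<dots> \<longleftrightarrow> x \<in> e i" using inj_on_image_mem_iff[OF inj\<phi> \<open>x \<in> V\<close> eV] .
      finally show ?thesis using \<open>x \<in> V\<close> by (simp add: e_def)
    qed
    show ?thesis
    proof (intro set_eqI iffI)
      fix j assume j: "j \<in> r (\<phi> x)"
      then have "j \<in> \<sigma> ` S" using sub[OF \<phi>V] bij\<sigma> by (auto simp: bij_betw_def)
      then show "j \<in> \<sigma> ` r x" using * j by blast
    next
      fix j assume "j \<in> \<sigma> ` r x"
      then show "j \<in> r (\<phi> x)" using * sub[OF that] by blast
    qed
  qed
  have "\<sigma> ` A \<in> r ` V" if "A \<in> r ` V" for A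
  proof -
    obtain x where "x \<in> V" "A = r x" using \<open>A \<in> r ` V\<close> by blast
    then have "\<sigma> ` A = r (\<phi> x)" "\<phi> x \<in> V" using r\<phi> im\<phi> by auto
    then show ?thesis by blast
  qed
  then have id: "\<sigma> i = i" if "i \<in> S" for i by (rule rigid[OF bij\<sigma> _ that])
  have x0V: "x0 \<in> V" using x0 by (simp add: dual_def)
  have "\<sigma> ` r x0 = r x0" using image_cong[OF refl, of "r x0" \<sigma> "\<lambda>i. i"] id sub[OF x0V] by (simp add: subsetD)
  then show "\<phi> x0 = x0"
    using inj_onD[OF assms(2), of "\<phi> x0" x0] r\<phi>[OF x0V] im\<phi> x0V by blast
qed

lemma neq_witness: "x \<notin> A \<Longrightarrow> x \<in> B \<Longrightarrow> A \<noteq> B"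
  by blast

section \<open>Vertices as sets of edge indices, and uniformity\<close>

text \<open>The three sets listed last are the vertex shared by \<open>e (n - 1)\<close> and \<open>e 0\<close>, the former vertex
  of degree one of \<open>e 0\<close>, and the vertex shared by \<open>e 0\<close> and \<open>e 1\<close>.\<close>

definition rim :: "nat \<Rightarrow> nat set set" where
  "rim n = (\<lambda>i. {i}) ` {1..n} \<union> (\<lambda>i. {i, Suc i}) ` {1..n-2} \<union> {{0,n-1}, {0,n}, {0,1,n}}"

definition band :: "nat \<Rightarrow> nat \<Rightarrow> nat set" where "band n j = {j..<n-j}"

text \<open>Bands are invariant under the reflection \<open>i \<mapsto> n - 1 - i\<close>. For even \<open>n\<close> the sizes \<open>n - 2 * j\<close>
  of the bands and \<open>2 * j + 1\<close> of their complements have different parities; starting at \<open>j = 2\<close>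
  makes all of them exceed 3.\<close>

definition padding :: "nat \<Rightarrow> nat \<Rightarrow> nat set set" where
  "padding k n = band n ` {2..k-2} \<union> (\<lambda>j. {..n} - band n j) ` {2..k-2}"

text \<open>These sets are the vertices before encoding: edge \<open>i\<close> will consist of the
  sets containing \<open>i\<close>.\<close>

definition stars :: "nat \<Rightarrow> nat \<Rightarrow> nat set set" where
  "stars k n = rim n \<union> padding k n"

text \<open>The cycle has length \<open>n\<close>, and the extra edge has index \<open>n\<close>.
  The lower bound on \<open>n\<close> leaves every band in the padding at least
  \<open>n - 2 * (k - 2) \<ge> 4\<close> elements.\<close>

locale construction =
  fixes k n :: nat
  assumes k: "k \<ge> 3" and n: "even n" "n \<ge> 2 * k"
begin

lemma n6: "n \<ge> 6" using k n by linarith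

lemma finite_stars: "finite (stars k n)"
  by (simp add: stars_def rim_def padding_def)

lemma stars_sub: "A \<in> stars k n \<Longrightarrow> A \<subseteq> {..n}"
  using n6 by (auto simp: stars_def rim_def padding_def band_def)

lemma card_band: "card (band n j) = n - 2 * j"
  by (simp add: band_def)

lemma card_coband: "j \<in> {2..k-2} \<Longrightarrow> card ({..n} - band n j) = Suc (2 * j)"
proof -
  assume j: "j \<in> {2..k-2}"
  have "card ({..n} - band n j) = card {..n} - card (band n j)"
    by (rule card_Diff_subset) (auto simp: band_def)
  then show ?thesis using j n k by (auto simp: card_band)
qed

lemma card_rim: "A \<in> rim n \<Longrightarrow> card A \<le> 3"
  using n6 by (auto simp: rim_def card_insert_if)

lemma card_padding: "A \<in> padding k n \<Longrightarrow> card A \<ge> 4"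
  using n k by (auto simp: padding_def card_band card_coband)

text \<open>Cardinality separates rim from padding, so a permutation preserving
  \<open>stars k n\<close> also preserves \<open>rim n\<close>, where rigidity can be
  argued.\<close>

lemma rim_iff: "A \<in> rim n \<longleftrightarrow> A \<in> stars k n \<and> card A \<le> 3"
  using card_rim card_padding unfolding stars_def by fastforce

text \<open>For each of the \<open>k - 3\<close> values of \<open>j\<close>, the index
  \<open>i\<close> lies in exactly one of the band and its complement. Sizes and their parity show
  that different \<open>j\<close> give different sets.\<close>

lemma card_padding_containing:
  assumes "i \<le> n" shows "card {A \<in> padding k n. i \<in> A} = k - 3"
proof -
  define f where "f j = (if i \<in> band n j then band n j else {..n} - band n j)" for j
  have "{A \<in> padding k n. i \<in> A} = f ` {2..k-2}"
    using assms by (auto simp: padding_def f_def image_iff)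
  moreover have "inj_on f {2..k-2}"
  proof (rule inj_onI)
    fix a b assume a: "a \<in> {2..k-2}" and b: "b \<in> {2..k-2}" and "f a = f b"
    then have "card (f a) = card (f b)" by simp
    then have "(if i \<in> band n a then n - 2 * a else Suc (2 * a)) =
               (if i \<in> band n b then n - 2 * b else Suc (2 * b))"
      using a b by (simp add: f_def card_band card_coband split: if_splits)
    moreover have "even (n - 2 * j)" for j using n by simp
    then have "n - 2 * j \<noteq> Suc (2 * j')" for j j' by (metis even_Suc even_mult_iff even_numeral)
    ultimately show "a = b" using a b n by (auto split: if_splits) metis+
  qed
  ultimately show ?thesis by (simp add: card_image)
qed

lemma rim_members:
  "\<And>i. 1 \<le> i \<Longrightarrow> i \<le> n \<Longrightarrow> {i} \<in> rim n"
  "\<And>i. 1 \<le> i \<Longrightarrow> Suc i < n \<Longrightarrow> {i, Suc i} \<in> rim n"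
  "{0,n-1} \<in> rim n" "{0,n} \<in> rim n" "{0,1,n} \<in> rim n"
  by (auto simp: rim_def)

text \<open>A typical cycle edge has one vertex of degree one and shares one vertex with each
  neighbour. The indices \<open>0\<close>, \<open>1\<close>, \<open>n - 1\<close> and
  \<open>n\<close> are treated apart because of the closing vertex \<open>{0,n-1}\<close> and the
  anchor \<open>{0,1,n}\<close>.\<close>

lemma card_rim_containing:
  assumes "i \<le> n" shows "card {A \<in> rim n. i \<in> A} = 3"
proof -
  consider "i = 0" | "i = 1" | "2 \<le> i" "i \<le> n - 2" | "i = n - 1" | "i = n" using assms by linarith
  then show ?thesis
  proof cases
    case 1
    have "{A \<in> rim n. i \<in> A} = {{0,n-1}, {0,n}, {0,1,n}}"
    proof
      show "{A \<in> rim n. i \<in> A} \<subseteq> {{0,n-1}, {0,n}, {0,1,n}}" using 1 by (auto simp: rim_def)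
    qed (use 1 rim_members(3-5) in blast)
    moreover have "{0,n-1} \<noteq> {0,n}" by (rule neq_witness[of "n"]) (use n6 in simp_all)
    moreover have "{0,n-1} \<noteq> {0,1,n}" by (rule neq_witness[of "n"]) (use n6 in simp_all)
    moreover have "{0,n} \<noteq> {0,1,n}" by (rule neq_witness[of "1"]) (use n6 in simp_all)
    ultimately show ?thesis by simp
  next
    case 2
    have **: "{1} \<in> rim n" "{1,2} \<in> rim n"
      using n6 rim_members(1,2)[of 1] by (simp_all add: numeral_2_eq_2)
    have "{A \<in> rim n. i \<in> A} = {{1}, {1,2}, {0,1,n}}"
    proof
      show "{A \<in> rim n. i \<in> A} \<subseteq> {{1}, {1,2}, {0,1,n}}"
        using 2 n6 by (auto simp: rim_def numeral_2_eq_2)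
    qed (use 2 ** rim_members(5) in blast)
    moreover have "{1::nat} \<noteq> {1,2}" by (rule neq_witness[of "2"]) (use n6 in simp_all)
    moreover have "{1::nat} \<noteq> {0,1,n}" by (rule neq_witness[of "0"]) (use n6 in simp_all)
    moreover have "{1,2} \<noteq> {0,1,n}" by (rule neq_witness[of "0"]) (use n6 in simp_all)
    ultimately show ?thesis by simp
  next
    case 3
    then have **: "{i} \<in> rim n" "{i-1,i} \<in> rim n" "{i,Suc i} \<in> rim n"
      using n6 rim_members(1,2)[of i] rim_members(2)[of "i-1"] by simp_all
    have "{A \<in> rim n. i \<in> A} = {{i}, {i-1,i}, {i,Suc i}}"
    proof
      show "{A \<in> rim n. i \<in> A} \<subseteq> {{i}, {i-1,i}, {i,Suc i}}"
        using 3 n6 by (auto simp: rim_def)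
    qed (use ** in blast)
    moreover have "{i} \<noteq> {i-1,i}" by (rule neq_witness[of "i-1"]) (use 3 n6 in simp_all)
    moreover have "{i} \<noteq> {i,Suc i}" by (rule neq_witness[of "Suc i"]) (use 3 n6 in simp_all)
    moreover have "{i-1,i} \<noteq> {i,Suc i}" by (rule neq_witness[of "Suc i"]) (use 3 n6 in simp_all)
    ultimately show ?thesis by simp
  next
    case 4
    have "Suc (n-2) = n-1" using n6 by simp
    then have **: "{n-1} \<in> rim n" "{n-2,n-1} \<in> rim n"
      using n6 rim_members(1)[of "n-1"] rim_members(2)[of "n-2"] by simp_all
    have "{A \<in> rim n. i \<in> A} = {{n-1}, {n-2,n-1}, {0,n-1}}"
    proof
      show "{A \<in> rim n. i \<in> A} \<subseteq> {{n-1}, {n-2,n-1}, {0,n-1}}"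
        using 4 n6 by (auto simp: rim_def)
    qed (use 4 ** rim_members(3) in blast)
    moreover have "{n-1} \<noteq> {n-2,n-1}" by (rule neq_witness[of "n-2"]) (use n6 in simp_all)
    moreover have "{n-1} \<noteq> {0,n-1}" by (rule neq_witness[of "0"]) (use n6 in simp_all)
    moreover have "{n-2,n-1} \<noteq> {0,n-1}" by (rule neq_witness[of "0"]) (use n6 in simp_all)
    ultimately show ?thesis by simp
  next
    case 5
    have "{n} \<in> rim n" using n6 rim_members(1)[of n] by simp
    have "{A \<in> rim n. i \<in> A} = {{n}, {0,n}, {0,1,n}}"
    proof
      show "{A \<in> rim n. i \<in> A} \<subseteq> {{n}, {0,n}, {0,1,n}}"
        using 5 n6 by (auto simp: rim_def)
    qed (use 5 \<open>{n} \<in> rim n\<close> rim_members(4,5) in blast)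
    moreover have "{n} \<noteq> {0,n}" by (rule neq_witness[of "0"]) (use n6 in simp_all)
    moreover have "{n} \<noteq> {0,1,n}" by (rule neq_witness[of "0"]) (use n6 in simp_all)
    moreover have "{0,n} \<noteq> {0,1,n}" by (rule neq_witness[of "1"]) (use n6 in simp_all)
    ultimately show ?thesis by simp
  qed
qed

lemma card_stars_containing:
  assumes "i \<le> n" shows "card {A \<in> stars k n. i \<in> A} = k"
proof -
  have "{A \<in> stars k n. i \<in> A} = {A \<in> rim n. i \<in> A} \<union> {A \<in> padding k n. i \<in> A}"
    by (auto simp: stars_def)
  moreover have "{A \<in> rim n. i \<in> A} \<inter> {A \<in> padding k n. i \<in> A} = {}"
    using card_rim card_padding by fastforce
  moreover have "finite {A \<in> rim n. i \<in> A}" "finite {A \<in> padding k n. i \<in> A}"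
    using finite_stars by (auto simp: stars_def)
  ultimately show ?thesis
    using card_rim_containing[OF assms] card_padding_containing[OF assms] k by (simp add: card_Un_disjoint)
qed

section \<open>Rigidity of the index structure\<close>

lemma rim_cases:
  assumes "A \<in> rim n"
  obtains i where "A = {i}" "i \<in> {1..n}" | i where "A = {i, Suc i}" "i \<in> {1..n-2}"
    | "A = {0,n-1}" | "A = {0,n}" | "A = {0,1,n}"
  using assms unfolding rim_def by (elim UnE imageE insertE emptyE) blast+

text \<open>Read as graph edges on the indices, the doubletons of the rim form the path
  \<open>n, 0, n - 1, n - 2, ..., 1\<close>.\<close>

lemma rim_pair:
  assumes "{a,b} \<in> rim n" "a < b"
  shows "1 \<le> a \<and> b = Suc a \<or> a = 0 \<and> (b = n - 1 \<or> b = n)"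
proof -
  show ?thesis
    using assms(1)
  proof (cases rule: rim_cases)
    case 5
    then have "card {a,b} = card {0,1,n}" by (rule arg_cong)
    then show ?thesis using n6 assms(2) by simp
  qed (use assms(2) in \<open>auto simp: doubleton_eq_iff\<close>)
qed

lemma stars_rigid:
  assumes bij: "bij_betw \<sigma> {..n} {..n}"
    and stable: "\<And>A. A \<in> stars k n \<Longrightarrow> \<sigma> ` A \<in> stars k n" and "i \<le> n"
  shows "\<sigma> i = i"
proof -
  have inj: "inj_on \<sigma> {..n}" using bij by (simp add: bij_betw_def)
  have card: "card (\<sigma> ` A) = card A" if "A \<in> stars k n" for A
    by (rule card_image[OF inj_on_subset[OF inj stars_sub[OF that]]])
  have rim: "\<sigma> ` A \<in> rim n" if "A \<in> rim n" for A
    using that card stable by (simp add: rim_iff)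
  have inj': "\<sigma> a = \<sigma> b \<longleftrightarrow> a = b" if "a \<le> n" "b \<le> n" for a b
    using inj that by (auto simp: inj_on_def)
  have card3: "A = {0,1,n}" if "A \<in> rim n" "card A = 3" for A
    using that n6 by (auto simp: rim_def card_insert_if split: if_splits)
  have tri: "{\<sigma> 0, \<sigma> 1, \<sigma> n} = {0,1,n}"
  proof -
    have "\<sigma> ` {0,1,n} = {0,1,n}"
    proof (rule card3)
      show "\<sigma> ` {0,1,n} \<in> rim n" by (rule rim[OF rim_members(5)])
      show "card (\<sigma> ` {0,1,n}) = 3"
        using card[of "{0,1,n}"] rim_members(5) n6 by (simp add: stars_def)
    qed
    then show ?thesis by simp
  qed
  \<comment> \<open>Edge \<open>0\<close> is the only one without a vertex of degree one:
    \<open>{0}\<close> is not in the rim.\<close>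
  have "{\<sigma> n} \<in> rim n" using rim[OF rim_members(1)[of n]] n6 by simp
  then have "\<sigma> n \<noteq> 0" using n6 by (auto simp: rim_def)
  have two: "{\<sigma> 0, \<sigma> n} \<in> rim n" using rim[OF rim_members(4)] by simp
  have no: "{0,1} \<notin> rim n" "{1,n} \<notin> rim n"
  proof -
    show "{0,1} \<notin> rim n"
    proof
      assume "{0,1} \<in> rim n"
      from rim_pair[OF this] n6 show False by simp
    qed
    show "{1,n} \<notin> rim n"
    proof
      assume "{1,n} \<in> rim n"
      from rim_pair[OF this] n6 show False by simp
    qed
  qed
  have ne: "\<sigma> 0 \<noteq> \<sigma> 1" "\<sigma> 0 \<noteq> \<sigma> n" "\<sigma> 1 \<noteq> \<sigma> n" using inj' n6 by auto
  have mem: "\<sigma> 0 \<in> {0,1,n}" "\<sigma> 1 \<in> {0,1,n}" "\<sigma> n \<in> {0,1,n}" using tri by blast+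
  \<comment> \<open>Within the anchor triple only \<open>{0,n}\<close> is a doubleton of the rim, so
    it is preserved and \<open>1\<close> is left over.\<close>
  have "\<sigma> 1 \<noteq> 0" "\<sigma> 1 \<noteq> n"
    using mem(1,3) two no ne by (metis insertE insert_commute singletonD)+
  then have base: "\<sigma> 0 = 0" "\<sigma> 1 = 1" "\<sigma> n = n"
    using mem ne \<open>\<sigma> n \<noteq> 0\<close> by simp_all
  have "\<sigma> m = m" if "m < n" for m
    using that
  proof (induction m rule: less_induct)
    case (less m)
    show ?case
    proof (cases "m \<le> 1")
      case True
      then have "m = 0 \<or> m = 1" by linarith
      then show ?thesis using base by blast
    next
      case False
      then obtain i where m: "m = Suc i" "1 \<le> i" by (cases m) auto
      have i: "\<sigma> i = i" using less m by simp
      have "{i, \<sigma> m} \<in> rim n" using rim[OF rim_members(2)[of i]] less.prems m i by simp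
      moreover have "\<sigma> m \<noteq> i" using inj'[of m i] i m less.prems by simp
      \<comment> \<open>This bound excludes the closing doubleton \<open>{0,n-1}\<close>, so
        \<open>\<sigma> m\<close> can only be a successor or predecessor of \<open>i\<close>; the
        predecessor is already fixed, hence taken.\<close>
      moreover have "i < n - 1" using less.prems m by simp
      ultimately have "\<sigma> m = Suc i \<or> Suc (\<sigma> m) = i"
        using rim_pair[of i "\<sigma> m"] rim_pair[of "\<sigma> m" i] m(2)
        by (cases i "\<sigma> m" rule: linorder_cases) (auto simp: insert_commute)
      moreover have "Suc (\<sigma> m) \<noteq> i"
      proof
        assume h: "Suc (\<sigma> m) = i"
        then have "\<sigma> (\<sigma> m) = \<sigma> m" using less.IH less.prems m by simp
        then show False using inj'[of "\<sigma> m" m] h m less.prems by simp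
      qed
      ultimately show ?thesis using m by simp
    qed
  qed
  then show ?thesis using base(3) \<open>i \<le> n\<close> by (cases "i = n") auto
qed

section \<open>Edge sets without twins\<close>

text \<open>If rim sets differ only by the index \<open>b\<close> and their common part meets
  \<open>S\<close>, they become twins unless \<open>b \<in> S\<close>. This forces indices along
  \<open>1, 2, ..., n - 1, 0, 1\<close>, and from \<open>n\<close> to \<open>0\<close>. Vertices on
  no edge of \<open>S\<close> are exempt, since a subgraph may omit them.\<close>

lemma twin_free_covers_cycle:
  assumes "S \<subseteq> {..n}" "S \<noteq> {}"
    and twin_free: "\<And>A B. A \<in> rim n \<Longrightarrow> B \<in> rim n \<Longrightarrow> A \<noteq> B \<Longrightarrow> A \<inter> S = B \<inter> S \<Longrightarrow> A \<inter> S = {}"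
  shows "{..<n} \<subseteq> S"
proof -
  have forced: "b \<in> S" if "a \<in> S" "a \<in> A" "A \<in> rim n" "insert b A \<in> rim n" "b \<notin> A" for a b A
  proof (rule ccontr)
    assume "b \<notin> S"
    then have "A \<inter> S = insert b A \<inter> S" by blast
    then show False using twin_free[of A "insert b A"] that by blast
  qed
  have step: "Suc i \<in> S" if "i \<in> S" "1 \<le> i" "Suc i < n" for i
    using forced[of i "{i}" "Suc i"] rim_members(1,2)[of i] that by (simp add: insert_commute)
  have climb: "j \<in> S" if "i \<le> j" "j < n" "i \<in> S" "1 \<le> i" for i j
    using that
    by (induction j rule: dec_induct) (use step in auto)
  have last: "0 \<in> S" if "n - 1 \<in> S"
    using forced[of "n-1" "{n-1}" 0] rim_members(1)[of "n-1"] rim_members(3) that n6 by simp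
  have chord: "0 \<in> S" if "n \<in> S"
    using forced[of n "{n}" 0] rim_members(1)[of n] rim_members(4) that n6 by simp
  have one: "1 \<in> S" if "0 \<in> S"
    using forced[of 0 "{0,n}" 1] rim_members(4,5) that n6 by (simp add: insert_commute)
  obtain i where i: "i \<in> S" "i \<le> n" using assms by blast
  have "0 \<in> S"
  proof (cases "i = 0 \<or> i = n")
    case False
    then have "i \<le> n - 1" "n - 1 < n" "1 \<le> i" using i n6 by linarith+
    then show ?thesis using climb[of i "n-1"] last i by blast
  qed (use i chord in auto)
  then have "1 \<in> S" by (rule one)
  show ?thesis
  proof
    fix j assume "j \<in> {..<n}"
    then show "j \<in> S" using climb[of 1 j] \<open>1 \<in> S\<close> \<open>0 \<in> S\<close> by (cases "j = 0") simp_all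
  qed
qed

section \<open>Reflection of the cycle without its extra edge\<close>

text \<open>Without edge \<open>n\<close>, the sets \<open>{0,n}\<close> and \<open>{0,1,n}\<close>
  turn into the missing degree-one vertex \<open>{0}\<close> and the ordinary shared vertex
  \<open>{0,1}\<close>. The cycle is then uniform and reversing it is a symmetry. The set
  \<open>{n}\<close> is excluded because it loses its only edge.\<close>

lemma reflection:
  assumes "A \<in> stars k n" "A \<noteq> {n}"
  shows "\<exists>B\<in>stars k n - {{n}}. B - {n} = (\<lambda>i. n - 1 - i) ` (A - {n})"
proof -
  let ?\<rho> = "\<lambda>i. n - 1 - i"
  have in_rim: ?thesis if "B \<in> rim n" "B \<noteq> {n}" "A - {n} = A'" "B - {n} = ?\<rho> ` A'" for A' B
    using that by (intro bexI[of _ B]) (simp_all add: stars_def)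
  have idx: "Suc (n - 2) = n - 1" "n - 2 \<noteq> n" "n - 1 \<noteq> n" "n \<noteq> 0" "n \<noteq> 1" using n6 by linarith+
  consider i where "A = {i}" "i \<in> {1..n}" | i where "A = {i, Suc i}" "i \<in> {1..n-2}"
    | "A = {0,n-1}" | "A = {0,n}" | "A = {0,1,n}"
    | j where "A = band n j" "j \<in> {2..k-2}" | j where "A = {..n} - band n j" "j \<in> {2..k-2}"
    using assms(1) unfolding stars_def rim_def padding_def by blast
  then show ?thesis
  proof cases
    case (1 i)
    then have i: "1 \<le> i" "i < n" using assms(2) by (auto simp: le_less)
    show ?thesis
    proof (cases "i = n - 1")
      case True
      show ?thesis
        by (rule in_rim[of "{0,n}" "{i}"]) (use 1 True i idx rim_members(4) in auto)
    next
      case False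
      then have "1 \<le> n - 1 - i" "n - 1 - i < n" using i by linarith+
      then show ?thesis
        by (intro in_rim[of "{n-1-i}" "{i}"] rim_members(1)) (use 1 i in auto)
    qed
  next
    case (2 i)
    then have i: "1 \<le> i" "i \<le> n - 2" by auto
    then have A: "A - {n} = {i, Suc i}" using 2 idx by auto
    show ?thesis
    proof (cases "i = n - 2")
      case True
      then have "n - 1 - i = 1" "n - 1 - Suc i = 0" using n6 by linarith+
      then show ?thesis
        by (intro in_rim[OF rim_members(5) _ A]) (use idx in auto)
    next
      case False
      then have *: "1 \<le> n - 2 - i" "Suc (n - 2 - i) < n"
        "n - 1 - i = Suc (n - 2 - i)" "n - 1 - Suc i = n - 2 - i" using i by linarith+
      then show ?thesis
        by (intro in_rim[OF rim_members(2)[OF *(1,2)] _ A]) auto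
    qed
  next
    case 3
    then show ?thesis
      by (intro in_rim[OF rim_members(3), of "{0,n-1}"]) (use idx in auto)
  next
    case 4
    have "{n-1} \<in> rim n" using n6 by (intro rim_members(1)) auto
    then show ?thesis
      by (rule in_rim[of _ "{0}"]) (use 4 idx in auto)
  next
    case 5
    have "{n-2, n-1} \<in> rim n" using rim_members(2)[of "n-2"] n6 idx by simp
    then show ?thesis
      by (rule in_rim[of _ "{0,1}"]) (use 5 idx in \<open>auto simp: numeral_2_eq_2\<close>)
  next
    case (6 j)
    have "x \<in> ?\<rho> ` band n j" if "x \<in> band n j" for x
      using that by (intro image_eqI[of _ _ "n - 1 - x"]) (auto simp: band_def)
    then have "?\<rho> ` band n j = band n j" using 6 by (auto simp: band_def)
    moreover have "band n j - {n} = band n j" by (auto simp: band_def)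
    moreover have "A \<noteq> {n}" using assms by simp
    ultimately show ?thesis using 6 assms by (intro bexI[of _ A]) auto
  next
    case (7 j)
    \<comment> \<open>The reflection exchanges these two end segments.\<close>
    have *: "A - {n} = {..<j} \<union> {n-j..<n}" using 7 n k by (auto simp: band_def)
    have "x \<in> ?\<rho> ` (A - {n})" if "x \<in> A - {n}" for x
      using that 7 n k unfolding * by (intro image_eqI[of _ _ "n - 1 - x"]) auto
    moreover have "?\<rho> ` (A - {n}) \<subseteq> A - {n}" unfolding * using 7 n k by auto
    ultimately have "A - {n} = ?\<rho> ` (A - {n})" by blast
    then show ?thesis using assms by blast
  qed
qed

text \<open>Traces must determine vertices for the reflection to lift. A collision needs one set
  with \<open>n\<close> and one without; the former contains \<open>0\<close>, so the latter is
  \<open>{0,n-1}\<close>, but \<open>{0,n-1,n}\<close> is not a vertex.\<close>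

lemma inj_trace: "inj_on (\<lambda>A. A - {n}) (stars k n - {{n}})"
proof -
  have with_n: "0 \<in> A" if "A \<in> stars k n" "n \<in> A" "A \<noteq> {n}" for A
    using that n6 by (auto simp: stars_def rim_def padding_def band_def)
  have without_n: "A = {0,n-1}" if "A \<in> stars k n" "n \<notin> A" "0 \<in> A" for A
    using that n6 by (auto simp: stars_def rim_def padding_def band_def)
  have "{0,n-1,n} \<notin> stars k n"
  proof
    assume "{0,n-1,n} \<in> stars k n"
    then have "{0,n-1,n} \<in> rim n" using n6 by (simp add: rim_iff card_insert_if)
    then show False
    proof (cases rule: rim_cases)
      case 5
      have "n - 1 \<in> {0,n-1,n}" by simp
      then have "n - 1 = 0 \<or> n - 1 = 1 \<or> n - 1 = n" unfolding 5 by simp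
      then show ?thesis using n6 by linarith
    qed (use n6 in \<open>simp_all add: set_eq_subset\<close>)
  qed
  then have "False" if "A \<in> stars k n" "B \<in> stars k n" "n \<in> A" "n \<notin> B" "A \<noteq> {n}" "A - {n} = B - {n}" for A B
  proof -
    have "0 \<in> A - {n}" using with_n[of A] that(1,3,5) n6 by simp
    then have "0 \<in> B" using \<open>A - {n} = B - {n}\<close> by blast
    then have "B = {0,n-1}" using without_n that by simp
    moreover have "A = insert n B"
      using \<open>A - {n} = B - {n}\<close> \<open>n \<in> A\<close> by (metis insert_Diff insert_Diff_single)
    ultimately have "A = {0,n-1,n}" by (simp add: insert_commute)
    then show False using that(1) \<open>{0,n-1,n} \<notin> stars k n\<close> by simp
  qed
  then have n_iff: "n \<in> A \<longleftrightarrow> n \<in> B"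
    if "A \<in> stars k n - {{n}}" "B \<in> stars k n - {{n}}" "A - {n} = B - {n}" for A B
    using that by (metis DiffE singletonI)
  show ?thesis
  proof (rule inj_onI)
    fix A B assume AB: "A \<in> stars k n - {{n}}" "B \<in> stars k n - {{n}}" "A - {n} = B - {n}"
    then show "A = B" using n_iff[OF AB] by (metis insert_Diff Diff_empty Diff_insert0)
  qed
qed

section \<open>The \<open>k\<close>-graph and its subgraphs\<close>

text \<open>\<open>set_encode\<close> turns the finite sets in \<open>stars k n\<close> into vertices of type \<open>nat\<close>.\<close>

definition verts :: "nat set" where "verts = set_encode ` stars k n"
definition G :: "nat hgraph" where "G = dual verts set_decode {..n}"

lemma decode_verts: "set_decode ` verts = stars k n"
  and inj_decode: "inj_on set_decode verts"
  and decode_sub: "x \<in> verts \<Longrightarrow> set_decode x \<subseteq> {..n}"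
  and finite_verts: "finite verts"
proof -
  have "finite A" if "A \<in> stars k n" for A
    using stars_sub[OF that] finite_subset by blast
  then have *: "set_decode (set_encode A) = A" if "A \<in> stars k n" for A
    using that by simp
  then show "set_decode ` verts = stars k n" by (force simp: verts_def image_image)
  then show "x \<in> verts \<Longrightarrow> set_decode x \<subseteq> {..n}" using stars_sub by blast
  show "inj_on set_decode verts" using * by (auto simp: verts_def intro!: inj_onI)
  show "finite verts" using finite_stars by (simp add: verts_def)
qed

definition edge :: "nat \<Rightarrow> nat set" where "edge i = {x\<in>verts. i \<in> set_decode x}"

lemma G_eq: "G = (verts, edge ` {..n})"
  by (simp add: G_def dual_def edge_def)

lemma decode_edge: "set_decode ` edge i = {A \<in> stars k n. i \<in> A}"
  using decode_verts by (auto simp: edge_def)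

lemma edge_sub: "edge i \<subseteq> verts" by (auto simp: edge_def)

text \<open>Of two distinct indices at least one is nonzero, and its degree-one vertex lies on that
  edge alone.\<close>

lemma inj_edge: "inj_on edge {..n}"
proof (rule inj_onI)
  fix i j assume ij: "i \<in> {..n}" "j \<in> {..n}" and eq: "edge i = edge j"
  then have eq: "{A \<in> stars k n. i \<in> A} = {A \<in> stars k n. j \<in> A}" using decode_edge by metis
  have *: "{a} \<in> stars k n" if "a \<noteq> 0" "a \<le> n" for a using that rim_members(1) by (simp add: stars_def)
  have mem: "i \<in> A \<longleftrightarrow> j \<in> A" if "A \<in> stars k n" for A
    using eq that by blast
  show "i = j"
  proof (cases "i = 0")
    case True
    then show ?thesis using mem[OF *[of j]] ij by (cases "j = 0") auto
  next
    case False
    then show ?thesis using mem[OF *[of i]] ij by auto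
  qed
qed

lemma kgraph_G: "kgraph k G"
proof -
  have "card (edge i) = k" if "i \<le> n" for i
    using card_stars_containing[OF that] card_image[OF inj_on_subset[OF inj_decode edge_sub]] decode_edge by metis
  then show ?thesis
    using finite_verts edge_sub finite_subset[OF edge_sub finite_verts]
    by (auto simp: kgraph_def G_eq nsets_def)
qed

lemma asymmetric_G: "asymmetric G"
  unfolding G_def
proof (rule asymmetric_dual)
  show "inj_on (\<lambda>i. {x \<in> verts. i \<in> set_decode x}) {..n}"
    using inj_edge by (simp add: edge_def[abs_def])
  fix \<sigma> i assume "bij_betw \<sigma> {..n} {..n}" "i \<in> {..n}"
    and "\<And>A. A \<in> set_decode ` verts \<Longrightarrow> \<sigma> ` A \<in> set_decode ` verts"
  then show "\<sigma> i = i" using stars_rigid[of \<sigma> i] by (simp add: decode_verts)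
qed (use inj_decode decode_sub in auto)

lemma symmetric_cycle:
  assumes V: "V = {x \<in> verts. set_decode x \<noteq> {n}}"
  shows "symmetric (V, edge ` {..<n})"
proof -
  define r where "r x = set_decode x - {n}" for x
  let ?\<rho> = "\<lambda>i. n - 1 - i"
  have "set_decode ` V = set_decode ` verts - {{n}}" unfolding V by auto
  then have decV: "set_decode ` V = stars k n - {{n}}" by (simp add: decode_verts)
  have rV: "r ` V = (\<lambda>A. A - {n}) ` (stars k n - {{n}})"
    unfolding decV[symmetric] by (simp add: r_def image_image)
  have VV: "V \<subseteq> verts" using V by blast
  have "inj_on ((\<lambda>A. A - {n}) \<circ> set_decode) V"
    by (rule comp_inj_on[OF inj_on_subset[OF inj_decode VV]]) (simp add: decV inj_trace)
  then have inj: "inj_on r V" by (simp add: r_def[abs_def] comp_def)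
  have dual: "(V, edge ` {..<n}) = dual V r {..<n}"
  proof -
    have "edge i = {x\<in>V. i \<in> r x}" if "i < n" for i
      using that by (auto simp: edge_def V r_def)
    then show ?thesis by (simp add: dual_def)
  qed
  have "bij_betw ?\<rho> {..<n} {..<n}"
    by (rule bij_betw_byWitness[of _ ?\<rho>]) auto
  moreover have "r x \<subseteq> {..<n}" if "x \<in> V" for x
    using decode_sub[of x] that V by (force simp: r_def)
  moreover have "?\<rho> ` r x \<in> r ` V" if "x \<in> V" for x
  proof -
    have "set_decode x \<in> stars k n - {{n}}" using decV that by blast
    then obtain B where "B \<in> stars k n - {{n}}" "B - {n} = ?\<rho> ` r x"
      using reflection[of "set_decode x"] unfolding r_def by blast
    then show ?thesis unfolding rV by (metis image_eqI)
  qed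
  ultimately obtain \<phi> where aut: "automorphism (dual V r {..<n}) \<phi>"
    and \<phi>: "\<And>x. x \<in> V \<Longrightarrow> r (\<phi> x) = ?\<rho> ` r x"
    using dual_automorphism[of V r "{..<n}" ?\<rho>] inj finite_subset[OF VV finite_verts] by blast
  \<comment> \<open>The degree-one vertex of edge \<open>1\<close> is moved to that of edge
    \<open>n - 2\<close>.\<close>
  have "{1} \<in> stars k n - {{n}}" using rim_members(1)[of 1] n6 by (simp add: stars_def)
  then obtain x where x: "x \<in> V" "set_decode x = {1}" using decV by (metis imageE)
  have "r x = {1}" using x(2) n6 by (auto simp: r_def)
  moreover have "r (\<phi> x) = {n - 2}" using \<phi>[OF x(1)] \<open>r x = {1}\<close> by (simp add: numeral_2_eq_2)
  ultimately have "\<phi> x \<noteq> x" using n6 by auto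
  then show ?thesis
    using aut x(1) unfolding dual symmetric_def asymmetric_def by (auto simp: dual_def)
qed

lemma symmetric_sub:
  assumes H: "nontrivial_sub_kgraph k H G"
  shows "symmetric H"
proof -
  have kH: "kgraph k H" and HV: "fst H \<subseteq> verts" and HE: "snd H \<subseteq> edge ` {..n}"
    and c1: "1 < card (fst H)" and c2: "card (fst H) < card verts"
    using H by (auto simp: nontrivial_sub_kgraph_def sub_kgraph_def G_eq)
  have proper: "fst H \<noteq> verts" using c2 by auto
  define S where "S = {i. i \<le> n \<and> edge i \<in> snd H}"
  have E: "snd H = edge ` S" using HE by (auto simp: S_def)
  have edgeH: "edge i \<subseteq> fst H" if "i \<in> S" for i
    using kH that by (auto simp: kgraph_def nsets_def S_def)
  show ?thesis
  proof (cases "S = {}")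
    case True
    \<comment> \<open>Without edges, any two vertices are twins.\<close>
    obtain x y where "x \<in> fst H" "y \<in> fst H" "x \<noteq> y"
      using c1 by (metis One_nat_def card_le_Suc0_iff_eq card.infinite not_less zero_le)
    then show ?thesis by (rule symmetric_twins) (simp add: E True)
  next
    case False
    show ?thesis
    proof (rule ccontr)
      assume asym: "\<not> symmetric H"
      have "{..<n} \<subseteq> S"
      proof (rule twin_free_covers_cycle)
        fix A B assume AB: "A \<in> rim n" "B \<in> rim n" "A \<noteq> B" and eq: "A \<inter> S = B \<inter> S"
        obtain x y where xy: "x \<in> verts" "y \<in> verts" "A = set_decode x" "B = set_decode y"
        proof -
          have "A \<in> set_decode ` verts" "B \<in> set_decode ` verts"
            using AB by (simp_all add: decode_verts stars_def)
          then show ?thesis using that by blast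
        qed
        show "A \<inter> S = {}"
        proof (rule ccontr)
          assume "A \<inter> S \<noteq> {}"
          then obtain i where i: "i \<in> S" "i \<in> A" "i \<in> B" using eq by blast
          then have "x \<in> fst H" "y \<in> fst H" using edgeH[of i] xy by (auto simp: edge_def)
          moreover have "x \<in> M \<longleftrightarrow> y \<in> M" if "M \<in> snd H" for M
            using that E eq xy by (auto simp: edge_def)
          moreover have "x \<noteq> y" using AB(3) xy(3,4) by blast
          ultimately show False using symmetric_twins[of x H y] asym by blast
        qed
      qed (use False in \<open>auto simp: S_def\<close>)
      \<comment> \<open>Every vertex except \<open>{n}\<close> lies on a cycle edge, so
        \<open>{n}\<close> is the only vertex that \<open>H\<close> can lack; lacking it,
        \<open>H\<close> lacks edge \<open>n\<close>.\<close>
      have sub: "{x \<in> verts. set_decode x \<noteq> {n}} \<subseteq> fst H"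
      proof clarify
        fix x assume x: "x \<in> verts" "set_decode x \<noteq> {n}"
        moreover have "{} \<notin> stars k n"
          using card_padding[of "{}"] by (auto simp: stars_def rim_def)
        ultimately have "set_decode x \<noteq> {}" using decode_verts by (metis imageI)
        then obtain i where "i \<in> set_decode x" "i \<noteq> n" using x(2) by blast
        moreover then have "i < n" using decode_sub[OF x(1)] by (auto simp: le_less)
        ultimately show "x \<in> fst H" using edgeH[of i] \<open>{..<n} \<subseteq> S\<close> x by (auto simp: edge_def)
      qed
      have "fst H = {x \<in> verts. set_decode x \<noteq> {n}}"
      proof -
        have "x = y" if "x \<in> verts" "y \<in> verts" "set_decode x = {n}" "set_decode y = {n}" for x y
          using that inj_decode by (metis inj_onD)
        then show ?thesis using sub HV proper by blast
      qed
      moreover have "n \<notin> S"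
      proof
        assume "n \<in> S"
        have "fst H = verts"
          using sub HV edgeH[OF \<open>n \<in> S\<close>] by (auto simp: edge_def)
        then show False using proper by simp
      qed
      then have "S = {..<n}" using \<open>{..<n} \<subseteq> S\<close> by (auto simp: S_def le_less)
      ultimately show False
        using asym symmetric_cycle E by (metis prod.collapse)
    qed
  qed
qed

lemma card_edges_G: "card (snd G) = Suc n"
  using card_image[OF inj_edge] by (simp add: G_eq)

end

section \<open>Infinitely many isomorphism classes\<close>

text \<open>The invariant that separates the members of the family. Edges are sets of vertices, so
  taking images under a bijection of the vertices is injective on them.\<close>

lemma isomorphic_card_edges:
  assumes "isomorphic G H" "kgraph k G"
  shows "card (snd G) = card (snd H)"
proof -
  obtain \<phi> where bij: "bij_betw \<phi> (fst G) (fst H)" and edges: "(`) \<phi> ` snd G = snd H"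
    using assms(1) by (auto simp: isomorphic_def isomorphism_def Setcompr_eq_image)
  have "snd G \<subseteq> Pow (fst G)" using assms(2) by (auto simp: kgraph_def nsets_def)
  then have "inj_on ((`) \<phi>) (snd G)"
    using bij inj_on_image_Pow inj_on_subset unfolding bij_betw_def by blast
  then show ?thesis using edges card_image by metis
qed

theorem theorem4:
  fixes k :: nat
  assumes "k \<ge> 3"
  shows "\<exists>\<G> :: nat hgraph set.
    infinite \<G> \<and>
    pairwise (\<lambda>G H. \<not> isomorphic G H) \<G> \<and>
    (\<forall>G \<in> \<G>.
      kgraph k G \<and>
      asymmetric G \<and>
      (\<forall>H. nontrivial_sub_kgraph k H G \<and> card (fst H) \<ge> 2 \<longrightarrow> symmetric H))"
proof -
  \<comment> \<open>The cycle length \<open>2 * (k + m)\<close> is even, at least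
    \<open>2 * k\<close>, and strictly increasing in \<open>m\<close>, as is the number of
    edges.\<close>
  define g where "g m = construction.G k (2 * (k + m))" for m
  have constr: "construction k (2 * (k + m))" for m
    using assms by unfold_locales simp_all
  have card: "card (snd (g m)) = Suc (2 * (k + m))" for m
    unfolding g_def by (rule construction.card_edges_G[OF constr])
  have kg: "kgraph k (g m)" for m
    unfolding g_def by (rule construction.kgraph_G[OF constr])
  have asym: "asymmetric (g m)" for m
    unfolding g_def by (rule construction.asymmetric_G[OF constr])
  have sub: "symmetric H" if "nontrivial_sub_kgraph k H (g m)" for H m
    using that unfolding g_def by (rule construction.symmetric_sub[OF constr])
  have "inj g"
  proof (rule injI)
    fix a b assume "g a = g b"
    then have "card (snd (g a)) = card (snd (g b))" by simp
    then show "a = b" by (simp add: card)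
  qed
  then have "infinite (range g)" by (simp add: range_inj_infinite)
  moreover have "pairwise (\<lambda>G H. \<not> isomorphic G H) (range g)"
  proof (rule pairwiseI)
    fix G H assume "G \<in> range g" "H \<in> range g" "G \<noteq> H"
    then obtain a b where "G = g a" "H = g b" "a \<noteq> b" by blast
    then show "\<not> isomorphic G H" using isomorphic_card_edges[of "g a" "g b"] kg card by auto
  qed
  ultimately show ?thesis using kg asym sub by blast
qed

end
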